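(* Let $l\in\{2,3\}$ and let $k\ge l$ be an integer. If $G$ is a connected claw-free $(k+l+1)$-regular graph of order $n$, then $\gamma_{p,k}(G)\le \frac{n}{k+l+2}$. Moreover, the bound is tight: there exist connected claw-free $(k+l+1)$-regular graphs $G$ of order $n$ with $\gamma_{p,k}(G)=\frac{n}{k+l+2}$.
   Context: All graphs are finite and simple. For a graph $G=(V,E)$, $N_G(v)$ is the open neighborhood of $v$, $N_G[v]=N_G(v)\cup\{v\}$, and for $S\subseteq V$, $N_G[S]=\bigcup_{v\in S}N_G[v]$. A graph is claw-free if it contains no induced subgraph isomorphic to $K_{1,3}$. For an integer $k\ge 0$ and $S\subseteq V$, define monitored sets by $P^0_G(S)=N_G[S]$ and $P^{i+1}_G(S)=\bigcup\{N_G[v]: v\in P^i_G(S) \text{ and } |N_G[v]\setminus P^i_G(S)|\le k\}$; these sets are increasing in $i$ and stabilize at a set $P^\infty_G(S)$. $S$ is a $k$-power dominating set ($k$-PDS) of $G$ if $P^\infty_G(S)=V$, and the $k$-power domination number $\gamma_{p,k}(G)$ is the minimum cardinality of a $k$-PDS of $G$. *)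

theory Defs
  imports "Graph_Theory.Graph_Theory"
begin

(* Finite simple graphs are represented as in the library, by symmetric loop-free
   digraphs (locales graph and pair_graph). *)

definition open_nbhd :: "('a, 'b) pre_digraph \<Rightarrow> 'a \<Rightarrow> 'a set" where
  "open_nbhd G v = {u. v \<rightarrow>\<^bsub>G\<^esub> u}"

definition closed_nbhd :: "('a, 'b) pre_digraph \<Rightarrow> 'a \<Rightarrow> 'a set" where
  "closed_nbhd G v = open_nbhd G v \<union> {v}"

definition closed_nbhd_set :: "('a, 'b) pre_digraph \<Rightarrow> 'a set \<Rightarrow> 'a set" where
  "closed_nbhd_set G S = (\<Union>v\<in>S. closed_nbhd G v)"

definition regular_graph :: "nat \<Rightarrow> ('a, 'b) pre_digraph \<Rightarrow> bool" where
  "regular_graph r G \<longleftrightarrow> (\<forall>v\<in>verts G. card (open_nbhd G v) = r)"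

(* The predicate complete_bipartite_digraph 1 3 is invariant under isomorphism, so an
   induced subgraph satisfying it is exactly an induced subgraph isomorphic to the claw. *)
definition claw_free :: "('a, 'b) pre_digraph \<Rightarrow> bool" where
  "claw_free G \<longleftrightarrow> \<not> (\<exists>H. induced_subgraph H G \<and> K\<^bsub>1,3\<^esub> H)"

primrec monitored :: "nat \<Rightarrow> ('a, 'b) pre_digraph \<Rightarrow> 'a set \<Rightarrow> nat \<Rightarrow> 'a set" where
  "monitored k G S 0 = closed_nbhd_set G S"
| "monitored k G S (Suc i) =
     \<Union> {closed_nbhd G v | v.
          v \<in> monitored k G S i \<and> card (closed_nbhd G v - monitored k G S i) \<le> k}"

(* The sets monitored k G S i increase with i, so on a finite graph their union is the
   set at which they stabilize. *)
definition monitored_inf :: "nat \<Rightarrow> ('a, 'b) pre_digraph \<Rightarrow> 'a set \<Rightarrow> 'a set" where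
  "monitored_inf k G S = (\<Union>i. monitored k G S i)"

definition power_dominating_set :: "nat \<Rightarrow> ('a, 'b) pre_digraph \<Rightarrow> 'a set \<Rightarrow> bool" where
  "power_dominating_set k G S \<longleftrightarrow> S \<subseteq> verts G \<and> monitored_inf k G S = verts G"

(* For a finite graph the minimum exists, since verts G is itself a k-power dominating set. *)
definition power_domination_number :: "nat \<Rightarrow> ('a, 'b) pre_digraph \<Rightarrow> nat" where
  "power_domination_number k G = (LEAST m. \<exists>S. power_dominating_set k G S \<and> card S = m)"

end

theory Submission
  imports Defs
begin

text \<open>
  Call a vertex \<open>z\<close> self-spreading if the set monitored by \<open>{z}\<close> contains \<open>N[N[z]]\<close>. Start from a
  maximal family \<open>P\<close> of self-spreading vertices with disjoint closed neighbourhoods and enlarge it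
  greedily as long as \<open>S\<close> monitors at least \<open>(k + l + 2) |S|\<close> vertices. Suppose this stops at a
  set \<open>M\<close> of monitored vertices that is not everything. A self-spreading vertex \<open>z\<close> outside \<open>M\<close>
  would extend \<open>P\<close>, because \<open>N[N[P]] \<subseteq> M\<close>. Otherwise every \<open>z\<close> outside \<open>M\<close> has a neighbour \<open>v\<close>
  in \<open>M\<close>, and by claw-freeness \<open>A v = N[v] - M\<close> is a clique with more than \<open>k\<close> elements, all of
  which propagate as soon as one of them is added. Failure of self-spreading gives each \<open>x \<in> A v\<close> a
  neighbour \<open>f x\<close> outside \<open>M\<close> and \<open>A v\<close>; such a vertex has at most \<open>l - 1\<close> neighbours in \<open>A v\<close>,
  and \<open>|A v| \<ge> k + 2\<close>. Adding a vertex of \<open>A v\<close> gains at most \<open>k + l + 1\<close> vertices, so there are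
  at most \<open>l - 1\<close> different \<open>f x\<close>, whence \<open>k + 2 \<le> (l - 1)\<^sup>2\<close>, which is false for \<open>l \<le> 3\<close> and
  \<open>k \<ge> l\<close>. Complete graphs attain the bound.
\<close>

section \<open>Monitored sets as closures under propagation\<close>

lemma mem_closed_nbhd [simp]: "v \<in> closed_nbhd G v"
  by (simp add: closed_nbhd_def)

lemma closed_nbhd_subset_monitored_Suc:
  "v \<in> monitored k G S i \<Longrightarrow> card (closed_nbhd G v - monitored k G S i) \<le> k
    \<Longrightarrow> closed_nbhd G v \<subseteq> monitored k G S (Suc i)"
  unfolding monitored.simps by (rule Union_upper) blast

text \<open>Vertices only enter as part of a whole closed neighbourhood, of an element of
  \<open>S\<close> or of a propagating vertex. The centre \<open>w\<close> later serves as a claw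
  leaf that sees nothing unmonitored.\<close>

lemma monitored_covered:
  assumes "x \<in> monitored k G S i"
  obtains w where "w \<in> monitored k G S i" "x \<in> closed_nbhd G w" "closed_nbhd G w \<subseteq> monitored k G S i"
proof (cases i)
  case 0
  with assms obtain s where "s \<in> S" "x \<in> closed_nbhd G s"
    by (auto simp: closed_nbhd_set_def)
  moreover from this have "closed_nbhd G s \<subseteq> monitored k G S i"
    using 0 by (auto simp: closed_nbhd_set_def)
  ultimately show thesis
    using that mem_closed_nbhd[of s G] by blast
next
  case (Suc j)
  with assms obtain v where v: "x \<in> closed_nbhd G v" "v \<in> monitored k G S j"
      "card (closed_nbhd G v - monitored k G S j) \<le> k"
    by auto
  then have "closed_nbhd G v \<subseteq> monitored k G S i"
    unfolding Suc by (intro closed_nbhd_subset_monitored_Suc)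
  with v show thesis
    using that mem_closed_nbhd[of v G] by blast
qed

lemma monitored_Suc: "monitored k G S i \<subseteq> monitored k G S (Suc i)"
proof
  fix x assume "x \<in> monitored k G S i"
  then obtain w where w: "w \<in> monitored k G S i" "x \<in> closed_nbhd G w"
      "closed_nbhd G w \<subseteq> monitored k G S i"
    by (rule monitored_covered)
  then have "closed_nbhd G w - monitored k G S i = {}"
    by blast
  then have "card (closed_nbhd G w - monitored k G S i) \<le> k"
    by (simp only: card.empty le0)
  with w show "x \<in> monitored k G S (Suc i)"
    using closed_nbhd_subset_monitored_Suc[of w k G S i] by blast
qed

lemma monitored_mono: "i \<le> j \<Longrightarrow> monitored k G S i \<subseteq> monitored k G S j"
  by (rule lift_Suc_mono_le[of "monitored k G S"]) (rule monitored_Suc)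

lemma monitored_inf_covered:
  assumes "x \<in> monitored_inf k G S"
  obtains w where "w \<in> monitored_inf k G S" "x \<in> closed_nbhd G w"
    "closed_nbhd G w \<subseteq> monitored_inf k G S"
proof -
  from assms obtain i where "x \<in> monitored k G S i"
    by (auto simp: monitored_inf_def)
  then obtain w where "w \<in> monitored k G S i" "x \<in> closed_nbhd G w"
      "closed_nbhd G w \<subseteq> monitored k G S i"
    by (rule monitored_covered)
  then show thesis
    using that unfolding monitored_inf_def by blast
qed

lemma closed_nbhd_subset_monitored_inf:
  assumes "s \<in> S"
  shows "closed_nbhd G s \<subseteq> monitored_inf k G S"
proof -
  have "closed_nbhd G s \<subseteq> monitored k G S 0"
    using assms by (auto simp: closed_nbhd_set_def)
  then show ?thesis
    unfolding monitored_inf_def by blast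
qed

text \<open>By finiteness, all vertices of \<open>N[v]\<close> that are ever monitored are so at a
  common stage \<open>m\<close>; the rule then fires at stage \<open>m + 1\<close>.\<close>

lemma monitored_inf_propagate:
  assumes fin: "finite (closed_nbhd G v)"
    and v: "v \<in> monitored_inf k G S" and "card (closed_nbhd G v - monitored_inf k G S) \<le> k"
  shows "closed_nbhd G v \<subseteq> monitored_inf k G S"
proof -
  let ?F = "closed_nbhd G v \<inter> monitored_inf k G S"
  have "\<forall>x\<in>?F. \<exists>i. x \<in> monitored k G S i"
    by (auto simp: monitored_inf_def)
  then obtain f where f: "\<And>x. x \<in> ?F \<Longrightarrow> x \<in> monitored k G S (f x)"
    by metis
  define m where "m = Max (f ` ?F)"
  have F: "?F \<subseteq> monitored k G S m"
  proof
    fix x assume x: "x \<in> ?F"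
    then have "f x \<le> m"
      unfolding m_def using fin by (intro Max_ge) auto
    from monitored_mono[OF this] f[OF x] show "x \<in> monitored k G S m"
      by (rule subsetD)
  qed
  then have "v \<in> monitored k G S m"
    using v by auto
  moreover have "closed_nbhd G v - monitored k G S m = closed_nbhd G v - monitored_inf k G S"
    using F by (auto simp: monitored_inf_def)
  ultimately have "closed_nbhd G v \<subseteq> monitored k G S (Suc m)"
    using assms(3) by (intro closed_nbhd_subset_monitored_Suc) simp_all
  then show ?thesis
    unfolding monitored_inf_def by blast
qed

text \<open>A larger set leaves fewer vertices missing from \<open>N[v]\<close>, so the threshold
  \<open>k\<close> is still met and induction on stages stays inside \<open>X\<close>.\<close>

lemma monitored_inf_least:
  assumes fin: "\<And>v. finite (closed_nbhd G v)"
    and dom: "\<And>s. s \<in> S \<Longrightarrow> closed_nbhd G s \<subseteq> X"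
    and closed: "\<And>v. v \<in> X \<Longrightarrow> card (closed_nbhd G v - X) \<le> k \<Longrightarrow> closed_nbhd G v \<subseteq> X"
  shows "monitored_inf k G S \<subseteq> X"
proof -
  have "monitored k G S i \<subseteq> X" for i
  proof (induction i)
    case 0
    then show ?case
      using dom by (auto simp: closed_nbhd_set_def)
  next
    case (Suc i)
    show ?case
    proof
      fix x assume "x \<in> monitored k G S (Suc i)"
      then obtain v where v: "x \<in> closed_nbhd G v" "v \<in> monitored k G S i"
          "card (closed_nbhd G v - monitored k G S i) \<le> k"
        by auto
      have "card (closed_nbhd G v - X) \<le> card (closed_nbhd G v - monitored k G S i)"
        using fin Suc by (intro card_mono) auto
      with v Suc closed[of v] show "x \<in> X"
        by auto
    qed
  qed
  then show ?thesis
    unfolding monitored_inf_def by blast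
qed

section \<open>Claws and closed neighbourhoods in a graph\<close>

lemma complete_bipartite_digraphI:
  assumes "graph G" "verts G = U \<union> V" "U \<inter> V = {}" "card U = m" "card V = n"
    "arcs_ends G = U \<times> V \<union> V \<times> U"
  shows "K\<^bsub>m,n\<^esub> G"
  unfolding complete_bipartite_digraph_def using assms by blast

context graph
begin

lemma closed_nbhd_commute: "u \<in> closed_nbhd G v \<longleftrightarrow> v \<in> closed_nbhd G u"
  using sym_arcs by (auto simp: closed_nbhd_def open_nbhd_def dest: arcs_ends_symmetric)

lemma closed_nbhd_subset_verts: "v \<in> verts G \<Longrightarrow> closed_nbhd G v \<subseteq> verts G"
  by (auto simp: closed_nbhd_def open_nbhd_def)

lemma finite_open_nbhd: "finite (open_nbhd G v)"
  by (rule finite_subset[OF _ finite_verts]) (auto simp: open_nbhd_def)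

lemma finite_closed_nbhd [simp]: "finite (closed_nbhd G v)"
  by (simp add: closed_nbhd_def finite_open_nbhd)

lemma card_closed_nbhd:
  assumes "regular_graph r G" "v \<in> verts G"
  shows "card (closed_nbhd G v) = Suc r"
proof -
  have "v \<notin> open_nbhd G v"
    by (auto simp: open_nbhd_def dest: adj_not_same)
  then show ?thesis
    using assms finite_open_nbhd by (simp add: closed_nbhd_def regular_graph_def)
qed

text \<open>With closed neighbourhoods no distinctness is required: if two of \<open>v\<close>,
  \<open>a\<close>, \<open>b\<close>, \<open>c\<close> coincide, one of the alternatives holds
  trivially. Otherwise their failure makes \<open>{v, a, b, c}\<close> induce a claw.\<close>

lemma claw_freeD:
  assumes "claw_free G" "v \<in> verts G"
    and abc: "a \<in> closed_nbhd G v" "b \<in> closed_nbhd G v" "c \<in> closed_nbhd G v"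
  shows "a \<in> closed_nbhd G b \<or> a \<in> closed_nbhd G c \<or> b \<in> closed_nbhd G c"
proof (rule ccontr)
  assume *: "\<not> ?thesis"
  let ?H = "G \<restriction> {v, a, b, c}"
  have sub: "{v, a, b, c} \<subseteq> verts G"
    using assms closed_nbhd_subset_verts by blast
  then have ind: "induced_subgraph ?H G"
    by (rule induced_induce)
  then have "digraph ?H" "symmetric ?H"
    using sym_arcs by (auto intro: digraphI_induced induced_graph_imp_symmetric)
  then have H: "graph ?H"
    by (rule digraph.graphI)
  have distinct: "v \<noteq> a" "v \<noteq> b" "v \<noteq> c" "a \<noteq> b" "a \<noteq> c" "b \<noteq> c"
    using * abc closed_nbhd_commute mem_closed_nbhd by metis+
  let ?A = "{a, b, c}"
  have nonadj: "\<not> x \<rightarrow>\<^bsub>G\<^esub> y" if "x \<in> ?A" "y \<in> ?A" for x y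
    using that * closed_nbhd_commute adj_not_same
    by (auto simp: closed_nbhd_def open_nbhd_def)
  have adj: "v \<rightarrow>\<^bsub>G\<^esub> x" "x \<rightarrow>\<^bsub>G\<^esub> v" if "x \<in> ?A" for x
    using that abc distinct arcs_ends_symmetric[OF sym_arcs]
    by (auto simp: closed_nbhd_def open_nbhd_def)
  have loop: "\<not> v \<rightarrow>\<^bsub>G\<^esub> v"
    using adj_not_same by blast
  have "(x, y) \<in> arcs_ends ?H \<longleftrightarrow> (x, y) \<in> {v} \<times> ?A \<union> ?A \<times> {v}" for x y
  proof -
    have "(x, y) \<in> arcs_ends ?H \<longleftrightarrow> x \<rightarrow>\<^bsub>G\<^esub> y \<and> x \<in> insert v ?A \<and> y \<in> insert v ?A"
      by (auto simp: arcs_ends_conv)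
    also have "\<dots> \<longleftrightarrow> x = v \<and> y \<in> ?A \<or> x \<in> ?A \<and> y = v"
      using adj[of x] adj[of y] nonadj[of x y] loop
      unfolding insert_iff[of _ v] by metis
    finally show ?thesis
      by (simp only: Un_iff mem_Times_iff fst_conv snd_conv singleton_iff)
  qed
  then have "arcs_ends ?H = {v} \<times> ?A \<union> ?A \<times> {v}"
    by (intro equalityI subrelI) (simp_all only:)
  with H have "K\<^bsub>1,3\<^esub> ?H"
    using distinct by (intro complete_bipartite_digraphI[of _ "{v}" ?A]) auto
  with ind \<open>claw_free G\<close> show False
    by (auto simp: claw_free_def)
qed

lemma monitored_inf_mono:
  assumes "S \<subseteq> T"
  shows "monitored_inf k G S \<subseteq> monitored_inf k G T"
proof (rule monitored_inf_least)
  show "closed_nbhd G s \<subseteq> monitored_inf k G T" if "s \<in> S" for s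
    using that assms by (intro closed_nbhd_subset_monitored_inf) auto
qed (simp_all add: monitored_inf_propagate)

lemma monitored_inf_subset_verts: "S \<subseteq> verts G \<Longrightarrow> monitored_inf k G S \<subseteq> verts G"
  using closed_nbhd_subset_verts by (intro monitored_inf_least) auto

lemma finite_monitored_inf: "S \<subseteq> verts G \<Longrightarrow> finite (monitored_inf k G S)"
  by (rule finite_subset[OF monitored_inf_subset_verts finite_verts])

end

section \<open>The frontier of a monitored set that is not everything\<close>

locale claw_free_regular_graph = graph G for G :: "('a, 'b) pre_digraph" +
  fixes k l :: nat
  assumes claw_free: "claw_free G"
    and regular: "regular_graph (k + l + 1) G"
    and l_le_k: "l \<le> k"
begin

abbreviation N :: "'a \<Rightarrow> 'a set" where "N \<equiv> closed_nbhd G"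

abbreviation cl :: "'a set \<Rightarrow> 'a set" where "cl \<equiv> monitored_inf k G"

lemma card_N: "v \<in> verts G \<Longrightarrow> card (N v) = k + l + 2"
  using card_closed_nbhd[OF regular] by simp

lemma frontier_card:
  assumes "v \<in> cl S" "\<not> N v \<subseteq> cl S"
  shows "k < card (N v - cl S)"
proof (rule ccontr)
  assume "\<not> ?thesis"
  then have "N v \<subseteq> cl S"
    using assms by (intro monitored_inf_propagate) auto
  with assms show False
    by blast
qed

text \<open>Some neighbour \<open>w\<close> of \<open>v\<close> has \<open>N w\<close> inside
  \<open>cl S\<close>, so \<open>w\<close> is adjacent to neither \<open>x\<close> nor
  \<open>z\<close>. If \<open>x\<close> and \<open>z\<close> were nonadjacent, \<open>v\<close>
  would be the centre of a claw.\<close>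

lemma frontier_clique:
  assumes S: "S \<subseteq> verts G" and v: "v \<in> cl S" and z: "z \<in> N v - cl S"
  shows "N v - cl S \<subseteq> N z"
proof
  fix x assume x: "x \<in> N v - cl S"
  obtain w where w: "v \<in> N w" "N w \<subseteq> cl S"
    using v by (rule monitored_inf_covered)
  have "v \<in> verts G"
    using S v monitored_inf_subset_verts by blast
  then have "w \<in> N x \<or> w \<in> N z \<or> x \<in> N z"
    using x z w closed_nbhd_commute by (intro claw_freeD[OF claw_free]) auto
  then show "x \<in> N z"
    using x z w(2) closed_nbhd_commute by blast
qed

text \<open>Each \<open>x\<close> in the clique sees at least \<open>k + 2\<close> monitored vertices, hence at most \<open>l \<le> k\<close> others.\<close>

lemma frontier_spread:
  assumes S: "S \<subseteq> verts G" and v: "v \<in> cl S" and z: "z \<in> N v - cl S" and x: "x \<in> N v - cl S"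
    and Nz: "N z \<subseteq> cl T"
  shows "N x \<subseteq> cl T"
proof -
  let ?A = "N v - cl S"
  have "v \<in> verts G"
    using S v monitored_inf_subset_verts by blast
  then have xV: "x \<in> verts G"
    using x closed_nbhd_subset_verts by blast
  have Ax: "insert v ?A \<subseteq> N x"
    using frontier_clique[OF S v x] x closed_nbhd_commute by blast
  have Az: "insert v ?A \<subseteq> cl T"
    using frontier_clique[OF S v z] z Nz closed_nbhd_commute by blast
  have "k < card ?A"
    using z by (intro frontier_card[OF v]) blast
  moreover have "card (insert v ?A) = Suc (card ?A)"
    using v by (intro card_insert_disjoint) auto
  ultimately have "k + 2 \<le> card (insert v ?A)"
    by simp
  moreover have "card (N x - insert v ?A) = card (N x) - card (insert v ?A)"
    using Ax by (intro card_Diff_subset) (auto intro: finite_subset)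
  moreover have "card (N x - cl T) \<le> card (N x - insert v ?A)"
    using Az by (intro card_mono) auto
  ultimately have "card (N x - cl T) \<le> k"
    using card_N[OF xV] l_le_k by simp
  with x Az show ?thesis
    by (intro monitored_inf_propagate) auto
qed

text \<open>This contradicts maximality of the packing once the greedy extension stops:
  \<open>gain\<close> says that no single vertex pays for itself, and \<open>small\<close> is what
  the final double count violates.\<close>

lemma stuck_imp_self_spreading:
  assumes S: "S \<subseteq> verts G" "cl S \<noteq> verts G"
    and gain: "\<And>z. z \<in> verts G - cl S \<Longrightarrow> card (cl (insert z S)) < card (cl S) + (k + l + 2)"
    and small: "(l - 1) * (l - 1) < k + 2"
  shows "\<exists>z\<in>verts G - cl S. \<forall>y\<in>N z. N y \<subseteq> cl {z}"
proof (rule ccontr)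
  assume neg: "\<not> ?thesis"
  \<comment> \<open>\<open>A v\<close> is the frontier clique at \<open>v\<close>, and
    \<open>D z\<close> is the set of vertices gained by adding \<open>z\<close>.\<close>
  define A where "A v = N v - cl S" for v
  define D where "D z = cl (insert z S) - cl S" for z
  have clV: "cl S \<subseteq> verts G"
    using S(1) by (rule monitored_inf_subset_verts)
  have finA [simp]: "finite (A v)" for v
    by (simp add: A_def)
  have insS: "insert z S \<subseteq> verts G" if "z \<in> verts G - cl S" for z
    using that S by blast
  have cl_ins: "cl S \<subseteq> cl (insert z S)" for z
    by (rule monitored_inf_mono) blast
  have N_ins: "N z \<subseteq> cl (insert z S)" for z
    by (rule closed_nbhd_subset_monitored_inf) simp
  have finD: "finite (D z)" if "z \<in> verts G - cl S" for z
    unfolding D_def using finite_monitored_inf[OF insS[OF that]] by simp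
  have card_D: "card (D z) \<le> k + l + 1" if "z \<in> verts G - cl S" for z
  proof -
    have "card (D z) = card (cl (insert z S)) - card (cl S)"
      unfolding D_def using finite_monitored_inf[OF S(1)] cl_ins by (rule card_Diff_subset)
    then show ?thesis
      using gain[OF that] by simp
  qed
  have A_U: "A v \<subseteq> verts G - cl S" if "v \<in> cl S" for v
    unfolding A_def using that clV closed_nbhd_subset_verts by blast
  have card_A: "k < card (A v)" if "v \<in> cl S" "z \<in> A v" for v z
    using that frontier_card unfolding A_def by blast
  have clique: "A v \<subseteq> N x" if "v \<in> cl S" "x \<in> A v" for v x
    using that frontier_clique[OF S(1)] unfolding A_def by blast
  have self: "N x \<subseteq> cl {z}" if "v \<in> cl S" "z \<in> A v" "x \<in> A v" for v x z
    using that frontier_spread[OF S(1)] closed_nbhd_subset_monitored_inf[of z "{z}"]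
    unfolding A_def by blast
  have spread: "N x - cl S \<subseteq> D z" if "v \<in> cl S" "z \<in> A v" "x \<in> A v" for v x z
    using that frontier_spread[OF S(1)] N_ins unfolding A_def D_def by blast
  have A_D: "A v \<subseteq> D z" if "v \<in> cl S" "z \<in> A v" for v z
    using spread[OF that] A_def by fastforce
  \<comment> \<open>Without a monitored neighbour, \<open>z\<close> would gain all
    \<open>k + l + 2\<close> vertices of \<open>N z\<close>.\<close>
  have boundary: "\<exists>v\<in>cl S. z \<in> A v" if z: "z \<in> verts G - cl S" for z
  proof (rule ccontr)
    assume "\<not> ?thesis"
    then have "N z \<inter> cl S = {}"
      using z closed_nbhd_commute unfolding A_def by blast
    then have "N z \<subseteq> D z"
      using N_ins unfolding D_def by blast
    then have "card (N z) \<le> card (D z)"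
      using finD[OF z] by (rule card_mono[rotated])
    then show False
      using card_D[OF z] card_N z by simp
  qed
  \<comment> \<open>If \<open>u\<close> does not capture \<open>A v\<close>, then \<open>v\<close>
    is still blocked, so more than \<open>k\<close> vertices of \<open>A v\<close> stay unmonitored;
    the captured \<open>x\<close> is one more.\<close>
  have big: "k + 2 \<le> card (A v)"
    if h: "v \<in> cl S" "u \<in> verts G - cl S" "x \<in> A v" "x \<in> N u" "\<not> A v \<subseteq> D u" for u v x
  proof -
    have "\<not> N v \<subseteq> cl (insert u S)"
      using h(5) unfolding A_def D_def by blast
    then have "k < card (N v - cl (insert u S))"
      using h(1) cl_ins by (intro frontier_card) auto
    moreover have "card (insert x (N v - cl (insert u S))) = Suc (card (N v - cl (insert u S)))"
      using h(4) N_ins by (intro card_insert_disjoint) auto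
    moreover have "card (insert x (N v - cl (insert u S))) \<le> card (A v)"
      using h(3) cl_ins by (intro card_mono) (auto simp: A_def)
    ultimately show ?thesis
      by simp
  qed
  have bad: "k + 2 \<le> card (A v) \<and> (\<exists>y. y \<in> N z - cl S - A v \<and> card (N y \<inter> A v) < l)"
    if v: "v \<in> cl S" and z: "z \<in> A v" for v z
  proof -
    have zU: "z \<in> verts G - cl S"
      using A_U v z by blast
    then obtain y where y: "y \<in> N z" "\<not> N y \<subseteq> cl {z}"
      using neg by blast
    have yV: "y \<in> verts G"
      using y zU closed_nbhd_subset_verts by blast
    have Nz: "N z \<subseteq> cl {z}"
      by (rule closed_nbhd_subset_monitored_inf) simp
    \<comment> \<open>\<open>y\<close> is in \<open>cl {z}\<close> but blocked there, so at most
      \<open>l + 1\<close> of the \<open>k + l + 2\<close> vertices of \<open>N y\<close> lie in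
      \<open>cl {z}\<close>, and \<open>l + 1\<close> is at most \<open>k + 1\<close>.\<close>
    have "k < card (N y - cl {z})"
      using y Nz by (intro frontier_card) auto
    moreover have "card (N y) = card (N y \<inter> cl {z}) + card (N y - cl {z})"
      using card_Un_disjoint[of "N y \<inter> cl {z}" "N y - cl {z}"] by (simp add: Int_Diff_Un Int_Diff_disjoint)
    ultimately have few: "card (N y \<inter> cl {z}) < k + 2"
      using card_N[OF yV] l_le_k by simp
    \<comment> \<open>A frontier clique together with its \<open>v'\<close> has at least
      \<open>k + 2\<close> vertices, too many for \<open>few\<close>.\<close>
    have many: False if "v' \<in> cl S" "x \<in> A v'" "insert v' (A v') \<subseteq> N y \<inter> cl {z}" for v' x
    proof -
      have "card (insert v' (A v')) = Suc (card (A v'))"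
        using that by (intro card_insert_disjoint) (auto simp: A_def)
      moreover have "card (insert v' (A v')) \<le> card (N y \<inter> cl {z})"
        using that by (intro card_mono) auto
      ultimately show False
        using few card_A[OF that(1,2)] by simp
    qed
    have "y \<notin> cl S"
    proof
      assume yM: "y \<in> cl S"
      then have zy: "z \<in> A y"
        using zU y closed_nbhd_commute unfolding A_def by blast
      have "A y \<subseteq> N z"
        using clique[OF yM zy] .
      then show False
        using many[OF yM zy] Nz y unfolding A_def by auto
    qed
    then have yU: "y \<in> verts G - cl S"
      using yV by blast
    then obtain v' where v': "v' \<in> cl S" "y \<in> A v'"
      using boundary by blast
    \<comment> \<open>A common vertex \<open>x\<close> would put \<open>A v'\<close> and
      \<open>v'\<close> into \<open>N x\<close>, which lies in \<open>cl {z}\<close> by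
      \<open>self\<close>, and both also lie in \<open>N y\<close>.\<close>
    have disj: "A v \<inter> A v' = {}"
    proof (rule ccontr)
      assume "A v \<inter> A v' \<noteq> {}"
      then obtain x where x: "x \<in> A v" "x \<in> A v'"
        by blast
      have "A v' \<subseteq> N x" "A v' \<subseteq> N y" "v' \<in> N x" "v' \<in> N y"
        using clique v' x closed_nbhd_commute unfolding A_def by blast+
      then show False
        using many[OF v'] self[OF v z x(1)] by blast
    qed
    \<comment> \<open>Two disjoint cliques of more than \<open>k\<close> vertices exceed the maximal
      gain \<open>k + l + 1\<close>, since \<open>l\<close> is at most \<open>k\<close>.\<close>
    have notsub: "\<not> A v \<union> A v' \<subseteq> D u" if u: "u \<in> verts G - cl S" for u
    proof
      assume "A v \<union> A v' \<subseteq> D u"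
      then have "card (A v \<union> A v') \<le> card (D u)"
        using finD[OF u] by (rule card_mono[rotated])
      moreover have "card (A v \<union> A v') = card (A v) + card (A v')"
        using disj by (intro card_Un_disjoint) auto
      ultimately show False
        using card_D[OF u] card_A[OF v z] card_A[OF v'] l_le_k by simp
    qed
    \<comment> \<open>Adding \<open>y\<close> captures \<open>A v'\<close>, hence not all of
      \<open>A v\<close>, although \<open>y\<close> sees \<open>z\<close> there. For
      \<open>big_v'\<close> the roles are swapped.\<close>
    have big_v: "k + 2 \<le> card (A v)"
      using big[OF v yU z] y closed_nbhd_commute notsub[OF yU] A_D[OF v'] by blast
    have big_v': "k + 2 \<le> card (A v')"
      using big[OF v'(1) zU v'(2)] y notsub[OF zU] A_D[OF v z] by blast
    \<comment> \<open>Of the \<open>k + l + 2\<close> vertices of \<open>N y\<close>, at least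
      \<open>k + 3\<close> are \<open>v'\<close> and \<open>A v'\<close>, leaving at most
      \<open>l - 1\<close> for \<open>A v\<close>.\<close>
    have "insert v' (A v' \<union> (N y \<inter> A v)) \<subseteq> N y"
      using clique v' closed_nbhd_commute unfolding A_def by blast
    then have "card (insert v' (A v' \<union> (N y \<inter> A v))) \<le> k + l + 2"
      using card_mono[OF finite_closed_nbhd] card_N[OF yV] by metis
    moreover have "card (insert v' (A v' \<union> (N y \<inter> A v))) = Suc (card (A v' \<union> (N y \<inter> A v)))"
      using v' by (intro card_insert_disjoint) (auto simp: A_def)
    moreover have "card (A v' \<union> (N y \<inter> A v)) = card (A v') + card (N y \<inter> A v)"
      using disj by (intro card_Un_disjoint) auto
    ultimately have "card (N y \<inter> A v) < l"
      using big_v' by simp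
    with big_v y yU v' disj show ?thesis
      by blast
  qed
  obtain z where "z \<in> verts G - cl S"
    using S clV by blast
  then obtain v where v: "v \<in> cl S" and z: "z \<in> A v"
    using boundary by blast
  obtain f where f: "\<And>x. x \<in> A v \<Longrightarrow> f x \<in> N x - cl S - A v \<and> card (N (f x) \<inter> A v) < l"
    using bad[OF v] by metis
  let ?Y = "f ` A v"
  \<comment> \<open>Each \<open>x\<close> is seen by its own \<open>f x\<close>, so the sets
    \<open>N y\<close> with \<open>y\<close> in \<open>?Y\<close> cover \<open>A v\<close>, each
    contributing at most \<open>l - 1\<close>.\<close>
  have "A v \<subseteq> (\<Union>y\<in>?Y. N y \<inter> A v)"
    using f closed_nbhd_commute by fastforce
  then have "card (A v) \<le> card (\<Union>y\<in>?Y. N y \<inter> A v)"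
    by (intro card_mono) auto
  also have "\<dots> \<le> (\<Sum>y\<in>?Y. card (N y \<inter> A v))"
    by (rule card_UN_le) simp
  also have "\<dots> \<le> card ?Y * (l - 1)"
    using f sum_bounded_above[of ?Y "\<lambda>y. card (N y \<inter> A v)" "l - 1"] by fastforce
  finally have upper: "card (A v) \<le> card ?Y * (l - 1)" .
  have zU: "z \<in> verts G - cl S"
    using A_U v z by blast
  \<comment> \<open>Adding \<open>z\<close> gains both \<open>?Y\<close> and \<open>A v\<close>; as
    \<open>A v\<close> takes at least \<open>k + 2\<close> of at most \<open>k + l + 1\<close>, only
    \<open>l - 1\<close> remain for \<open>?Y\<close>.\<close>
  have "?Y \<union> A v \<subseteq> D z"
    using f spread[OF v z] A_D[OF v z] by blast
  then have "card (?Y \<union> A v) \<le> k + l + 1"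
    using card_mono[OF finD[OF zU]] card_D[OF zU] le_trans by blast
  moreover have "card (?Y \<union> A v) = card ?Y + card (A v)"
    using f by (intro card_Un_disjoint) auto
  ultimately have "card ?Y \<le> l - 1" "k + 2 \<le> card (A v)"
    using bad[OF v z] by auto
  with upper have "k + 2 \<le> (l - 1) * (l - 1)"
    using mult_le_mono1 le_trans by meson
  then show False
    using small by simp
qed

text \<open>Two maximal choices are nested: a packing \<open>P\<close> of self-spreading vertices,
  then a set \<open>S\<close> containing \<open>P\<close> that monitors enough vertices per
  element.\<close>

lemma ex_small_power_dominating_set:
  assumes small: "(l - 1) * (l - 1) < k + 2"
  shows "\<exists>S. power_dominating_set k G S \<and> card S * (k + l + 2) \<le> card (verts G)"
proof -
  define packing where "packing S \<longleftrightarrow> S \<subseteq> verts G \<and> (\<forall>s\<in>S. \<forall>y\<in>N s. N y \<subseteq> cl {s})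
    \<and> (\<forall>s\<in>S. \<forall>t\<in>S. s \<noteq> t \<longrightarrow> N s \<inter> N t = {})" for S
  have card_le: "card S < Suc (card (verts G))" if "S \<subseteq> verts G" for S
    using that finite_verts by (simp add: card_mono less_Suc_eq_le)
  have "packing {}" "\<forall>Q. packing Q \<longrightarrow> card Q < Suc (card (verts G))"
    using card_le by (auto simp only: packing_def)
  from ex_has_greatest_nat[of packing, OF this]
  obtain P where P: "packing P" and P_max: "\<And>Q. packing Q \<Longrightarrow> card Q \<le> card P"
    by blast
  have PV: "P \<subseteq> verts G"
    using P by (simp add: packing_def)
  have finP: "finite P"
    using PV finite_verts by (rule finite_subset)
  define large where "large S \<longleftrightarrow> P \<subseteq> S \<and> S \<subseteq> verts G \<and> card S * (k + l + 2) \<le> card (cl S)" for S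
  \<comment> \<open>The disjoint closed neighbourhoods of \<open>P\<close> already supply the
    required number of monitored vertices.\<close>
  have "card P * (k + l + 2) = (\<Sum>s\<in>P. card (N s))"
    using PV card_N by (simp add: subset_iff)
  also have "\<dots> = card (\<Union>s\<in>P. N s)"
    using P finP unfolding packing_def
    by (intro card_UN_disjoint[symmetric]) auto
  also have "\<dots> \<le> card (cl P)"
    by (intro card_mono UN_least finite_monitored_inf PV closed_nbhd_subset_monitored_inf)
  finally have "large P"
    using PV by (simp add: large_def)
  moreover have "\<forall>T. large T \<longrightarrow> card T < Suc (card (verts G))"
    using card_le by (auto simp only: large_def)
  ultimately obtain S where S: "large S" and S_max: "\<And>T. large T \<Longrightarrow> card T \<le> card S"
    using ex_has_greatest_nat[of large P card] by blast
  have SV: "S \<subseteq> verts G"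
    using S by (simp add: large_def)
  have S_cl: "S \<subseteq> cl S"
    using closed_nbhd_subset_monitored_inf[of _ S G k] by fastforce
  have finS: "finite S"
    using SV finite_verts by (rule finite_subset)
  have "cl S = verts G"
  proof (rule ccontr)
    assume "cl S \<noteq> verts G"
    moreover have "card (cl (insert z S)) < card (cl S) + (k + l + 2)" if z: "z \<in> verts G - cl S" for z
    proof (rule ccontr)
      assume *: "\<not> ?thesis"
      have "card (insert z S) = Suc (card S)"
        using z S_cl finS by (intro card_insert_disjoint) auto
      moreover from this have "large (insert z S)"
        using S z * unfolding large_def by auto
      ultimately show False
        using S_max by fastforce
    qed
    ultimately obtain z where z: "z \<in> verts G - cl S" "\<forall>y\<in>N z. N y \<subseteq> cl {z}"
      using stuck_imp_self_spreading[OF SV _ _ small] by blast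
    \<comment> \<open>A common \<open>y\<close> would give \<open>z\<close> in \<open>N y\<close>,
      inside \<open>cl {s}\<close> because \<open>s\<close> is self-spreading, and so inside
      \<open>cl S\<close>.\<close>
    have "N s \<inter> N z = {}" if s: "s \<in> P" for s
    proof (rule ccontr)
      assume "N s \<inter> N z \<noteq> {}"
      then obtain y where y: "y \<in> N s" "z \<in> N y"
        using closed_nbhd_commute by blast
      have "cl {s} \<subseteq> cl S"
        using s S by (intro monitored_inf_mono) (auto simp: large_def)
      with y z(1) s P show False
        unfolding packing_def by blast
    qed
    then have "packing (insert z P)"
      using P z unfolding packing_def by (simp add: Int_commute)
    moreover have "z \<notin> P"
      using z S S_cl unfolding large_def by blast
    then have "card (insert z P) = Suc (card P)"
      using finP by (intro card_insert_disjoint) auto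
    ultimately show False
      using P_max by fastforce
  qed
  with S SV show ?thesis
    by (auto simp: large_def power_dominating_set_def)
qed

end

section \<open>The power domination number and the extremal complete graphs\<close>

lemma power_domination_number_le:
  "power_dominating_set k G S \<Longrightarrow> power_domination_number k G \<le> card S"
  unfolding power_domination_number_def by (rule Least_le) blast

lemma power_domination_number_attained:
  assumes "power_dominating_set k G T"
  shows "\<exists>S. power_dominating_set k G S \<and> card S = power_domination_number k G"
  unfolding power_domination_number_def
  by (rule LeastI[of "\<lambda>m. \<exists>S. power_dominating_set k G S \<and> card S = m" "card T"])
    (use assms in blast)

text \<open>Any one vertex dominates everything, while the empty set monitors nothing.\<close>

lemma power_domination_number_complete:
  assumes "K\<^bsub>n\<^esub> G" "n > 0"
  shows "power_domination_number k G = 1"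
proof -
  interpret graph G
    using assms(1) by (simp add: complete_digraph_def)
  have card: "card (verts G) = n" and ends: "arcs_ends G = {(u, v). (u, v) \<in> verts G \<times> verts G \<and> u \<noteq> v}"
    using assms(1) by (simp_all add: complete_digraph_def)
  obtain v where v: "v \<in> verts G"
    using card assms(2) by (metis card.empty ex_in_conv less_irrefl)
  have "closed_nbhd G v = verts G"
    using v ends by (auto simp: closed_nbhd_def open_nbhd_def)
  then have "verts G \<subseteq> monitored_inf k G {v}"
    using closed_nbhd_subset_monitored_inf[of v "{v}" G k] by simp
  then have pds: "power_dominating_set k G {v}"
    using v monitored_inf_subset_verts[of "{v}" k] by (auto simp: power_dominating_set_def)
  have "power_domination_number k G \<noteq> 0"
  proof
    assume "power_domination_number k G = 0"
    with power_domination_number_attained[OF pds]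
    obtain S where S: "power_dominating_set k G S" "card S = 0"
      by metis
    have "finite S"
      using S(1) by (intro finite_subset[OF _ finite_verts]) (simp add: power_dominating_set_def)
    with S(2) have "S = {}"
      by simp
    moreover have "monitored_inf k G {} \<subseteq> {}"
      by (rule monitored_inf_least) auto
    ultimately show False
      using S(1) v by (auto simp: power_dominating_set_def)
  qed
  then show ?thesis
    using power_domination_number_le[OF pds] by simp
qed

lemma regular_graph_complete:
  assumes "K\<^bsub>n\<^esub> G"
  shows "regular_graph (n - 1) G"
  unfolding regular_graph_def
proof
  fix v assume "v \<in> verts G"
  with assms have "open_nbhd G v = verts G - {v}"
    by (auto simp: complete_digraph_def open_nbhd_def)
  with assms \<open>v \<in> verts G\<close> show "card (open_nbhd G v) = n - 1"
    by (simp add: complete_digraph_def)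
qed

text \<open>Two leaves of an induced claw would be nonadjacent.\<close>

lemma claw_free_complete:
  assumes "K\<^bsub>n\<^esub> G"
  shows "claw_free G"
  unfolding claw_free_def
proof
  assume "\<exists>H. induced_subgraph H G \<and> K\<^bsub>1,3\<^esub> H"
  then obtain H where ind: "induced_subgraph H G" and H: "K\<^bsub>1,3\<^esub> H"
    by blast
  then obtain U V where UV: "verts H = U \<union> V" "U \<inter> V = {}" "card V = 3"
      "arcs_ends H = U \<times> V \<union> V \<times> U"
    by (auto simp: complete_bipartite_digraph_def)
  then obtain a b where ab: "a \<in> V" "b \<in> V" "a \<noteq> b"
    by (metis card_3_iff insert_iff)
  have "{a, b} \<subseteq> verts G"
    using ind UV(1) ab by (auto simp: induced_subgraph_def subgraph_def)
  then have "(a, b) \<in> arcs_ends G"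
    using assms ab by (auto simp: complete_digraph_def)
  then have "(a, b) \<in> arcs_ends H"
    using ind ab UV(1) by (auto simp: induced_subgraph_def subgraph_def compatible_def arcs_ends_conv)
  with UV ab show False
    by auto
qed

lemma connected_complete:
  assumes "K\<^bsub>n\<^esub> G" "n > 0"
  shows "Digraph_Component.connected G"
proof -
  interpret graph G
    using assms(1) by (simp add: complete_digraph_def)
  show ?thesis
    unfolding Digraph_Component.connected_def
  proof (rule strongly_connectedI)
    show "verts (mk_symmetric G) \<noteq> {}"
      using assms by (auto simp: complete_digraph_def mk_symmetric_def)
    fix u v assume "u \<in> verts (mk_symmetric G)" "v \<in> verts (mk_symmetric G)"
    then have "u \<rightarrow>\<^sup>*\<^bsub>G\<^esub> v"
      using assms(1) by (cases "u = v") (auto simp: complete_digraph_def mk_symmetric_def)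
    then show "u \<rightarrow>\<^sup>*\<^bsub>mk_symmetric G\<^esub> v"
      by (rule reachable_mk_symmetricI)
  qed
qed

theorem theorem1:
  fixes k l :: nat
  assumes "l \<in> {2, 3}" and "k \<ge> l"
  shows "(\<forall>G :: 'a pair_pre_digraph.
            pair_graph G \<and> Digraph_Component.connected (with_proj G) \<and>
            claw_free (with_proj G) \<and> regular_graph (k + l + 1) (with_proj G) \<longrightarrow>
            real (power_domination_number k (with_proj G))
              \<le> real (card (pverts G)) / real (k + l + 2)) \<and>
         (\<exists>G :: nat pair_pre_digraph.
            pair_graph G \<and> Digraph_Component.connected (with_proj G) \<and>
            claw_free (with_proj G) \<and> regular_graph (k + l + 1) (with_proj G) \<and>
            real (power_domination_number k (with_proj G))
              = real (card (pverts G)) / real (k + l + 2))"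
proof (intro conjI allI impI, elim conjE)
  fix G :: "'a pair_pre_digraph"
  assume G: "pair_graph G" "claw_free (with_proj G)" "regular_graph (k + l + 1) (with_proj G)"
  then interpret claw_free_regular_graph "with_proj G" k l
    using assms by (simp add: claw_free_regular_graph_def claw_free_regular_graph_axioms_def
        pair_graph.pair_graphD_graph)
  \<comment> \<open>For \<open>l = 2\<close> this reads \<open>1 < k + 2\<close>; for
    \<open>l = 3\<close> it reads \<open>4 < k + 2\<close>, true since \<open>k\<close> is at least
    3.\<close>
  have "(l - 1) * (l - 1) < k + 2"
    using assms by auto
  then obtain S where S: "power_dominating_set k (with_proj G) S"
      "card S * (k + l + 2) \<le> card (verts (with_proj G))"
    using ex_small_power_dominating_set by blast
  have "power_domination_number k (with_proj G) * (k + l + 2) \<le> card S * (k + l + 2)"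
    using power_domination_number_le[OF S(1)] by (rule mult_le_mono1)
  also have "\<dots> \<le> card (pverts G)"
    using S(2) by simp
  finally have "real (power_domination_number k (with_proj G)) * real (k + l + 2) \<le> real (card (pverts G))"
    unfolding of_nat_mult[symmetric] of_nat_le_iff .
  then show "real (power_domination_number k (with_proj G)) \<le> real (card (pverts G)) / real (k + l + 2)"
    by (subst pos_le_divide_eq) simp_all
next
  let ?n = "k + l + 2"
  \<comment> \<open>On \<open>k + l + 2\<close> vertices the complete graph has the right degree,
    and the bound equals 1.\<close>
  define G :: "nat pair_pre_digraph"
    where "G = \<lparr>pverts = {..<?n}, parcs = {(u, v). (u, v) \<in> {..<?n} \<times> {..<?n} \<and> u \<noteq> v}\<rparr>"
  have K: "K\<^bsub>?n\<^esub> (with_proj G)"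
    by (simp add: complete_digraph_pair_def G_def)
  have "card (pverts G) = ?n"
    by (simp add: G_def)
  then show "\<exists>G :: nat pair_pre_digraph.
            pair_graph G \<and> Digraph_Component.connected (with_proj G) \<and>
            claw_free (with_proj G) \<and> regular_graph (k + l + 1) (with_proj G) \<and>
            real (power_domination_number k (with_proj G))
              = real (card (pverts G)) / real (k + l + 2)"
    using pair_graphI_complete[OF K] connected_complete[OF K] claw_free_complete[OF K]
      regular_graph_complete[OF K] power_domination_number_complete[OF K, of k]
    by (intro exI[of _ G]) simp
qed

end
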